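(* Let $\theta\colon\mathbb{Z}\to\mathbb{Z}$, $z\mapsto 0$, be the annihilating homomorphism of the additive group of integers, and let $\tau$ be a Hausdorff locally compact shift-continuous topology on $\mathbf{B}(\mathbb{Z},\theta)^0$ such that the topology induced by $\tau$ on $\mathbf{B}(\mathbb{Z},\theta)$ coincides with $\tau_{+}$. Then the zero $\mathbf{0}$ of $\mathbf{B}(\mathbb{Z},\theta)^0$ is an isolated point of $\left(\mathbf{B}(\mathbb{Z},\theta)^0,\tau\right)$.
   Context: $\mathbb{N}$ is the set of positive integers and $\mathbb{N}_0$ the set of non-negative integers. A topology on a semigroup is shift-continuous if multiplication is separately continuous. The Reilly semigroup $\mathbf{B}(\mathbb{Z},\theta)$ is the set $\mathbb{N}_0\times\mathbb{Z}\times\mathbb{N}_0$ with $$(i,s,j)\cdot(m,t,n)=\left(i+m-\min\{j,m\},\ \theta^{m-\min\{j,m\}}(s)+\theta^{j-\min\{j,m\}}(t),\ j+n-\min\{j,m\}\right),$$ where $\theta^0$ is the identity map and $\theta^k$ is the $k$-fold iterate. $\mathbf{B}(\mathbb{Z},\theta)^0=\mathbf{B}(\mathbb{Z},\theta)\sqcup\{\mathbf{0}\}$ is $\mathbf{B}(\mathbb{Z},\theta)$ with an adjoined zero $\mathbf{0}$. For $A\subseteq\mathbb{Z}$ and $i,j\in\mathbb{N}_0$ put $A_{i,j}=\{(i,s,j)\colon s\in A\}$ and $A_{i,j}^0=A_{i,j}\cup\{(i+1,0,j+1)\}$. The topology $\tau_{+}$ on $\mathbf{B}(\mathbb{Z},\theta)$: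 a point $(i,g,j)$ is isolated if $g\neq 0$, or $i=0$, or $j=0$; for $i,j\in\mathbb{N}$ a base at $(i,0,j)$ consists of all sets $(\mathbb{N}\setminus F)_{i-1,j-1}^0$, $F$ a finite subset of $\mathbb{N}$. *)

theory Defs
  imports "HOL-Analysis.Analysis"
begin

type_synonym reilly = "nat \<times> int \<times> nat"

text \<open>Multiplication of the Reilly semigroup over the additive group of integers. All
  subtractions are exact, since the subtrahend is at most \<open>j\<close> and at most \<open>m\<close>.\<close>

fun reilly_mult :: "(int \<Rightarrow> int) \<Rightarrow> reilly \<Rightarrow> reilly \<Rightarrow> reilly" where
  "reilly_mult \<theta> (i, s, j) (m, t, n) =
     (i + m - min j m,
      (\<theta> ^^ (m - min j m)) s + (\<theta> ^^ (j - min j m)) t,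
      j + n - min j m)"

text \<open>A semigroup with an adjoined zero lives on the option type, \<open>None\<close> being the zero.\<close>

fun adjoin_zero :: "('a \<Rightarrow> 'a \<Rightarrow> 'a) \<Rightarrow> 'a option \<Rightarrow> 'a option \<Rightarrow> 'a option" where
  "adjoin_zero f (Some x) (Some y) = Some (f x y)"
| "adjoin_zero f None y = None"
| "adjoin_zero f x None = None"

definition shift_continuous :: "('a \<Rightarrow> 'a \<Rightarrow> 'a) \<Rightarrow> 'a topology \<Rightarrow> bool" where
  "shift_continuous f X \<longleftrightarrow>
     (\<forall>a\<in>topspace X. continuous_map X X (\<lambda>x. f a x) \<and> continuous_map X X (\<lambda>x. f x a))"

definition layer :: "int set \<Rightarrow> nat \<Rightarrow> nat \<Rightarrow> reilly set" where
  "layer A i j = {(i, s, j) |s. s \<in> A}"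

definition layer0 :: "int set \<Rightarrow> nat \<Rightarrow> nat \<Rightarrow> reilly set" where
  "layer0 A i j = layer A i j \<union> {(i + 1, 0, j + 1)}"

definition tau_plus :: "reilly topology" where
  "tau_plus = topology_generated_by
     ({{(i, g, j)} |i g j. g \<noteq> 0 \<or> i = 0 \<or> j = 0} \<union>
      {layer0 ({0<..} - F) (i - 1) (j - 1) |i j F. 0 < i \<and> 0 < j \<and> finite F \<and> F \<subseteq> {0<..}})"

text \<open>The generating family is a base, and it yields the prescribed neighbourhood bases.\<close>

lemma openin_tau_plus:
  "openin tau_plus U \<longleftrightarrow>
     (\<forall>i j. 0 < i \<longrightarrow> 0 < j \<longrightarrow> (i, 0, j) \<in> U \<longrightarrow>
        (\<exists>F. finite F \<and> F \<subseteq> {0<..} \<and> layer0 ({0<..} - F) (i - 1) (j - 1) \<subseteq> U))"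
  (is "_ \<longleftrightarrow> ?P U")
proof
  let ?S = "{{(i, g, j)} |i g j. g \<noteq> 0 \<or> i = 0 \<or> j = 0} \<union>
      {layer0 ({0<..} - F) (i - 1) (j - 1) |i j F. 0 < i \<and> 0 < j \<and> finite F \<and> F \<subseteq> {0<..}}
      :: reilly set set"
  assume "openin tau_plus U"
  then have "generate_topology_on ?S U"
    unfolding tau_plus_def by (rule openin_topology_generated_by)
  then show "?P U"
  proof (induction rule: generate_topology_on.induct)
    case Empty
    then show ?case by simp
  next
    case (Int a b)
    show ?case
    proof (intro allI impI)
      fix i j :: nat
      assume ij: "0 < i" "0 < j" "(i, 0, j) \<in> a \<inter> b"
      then have ab: "(i, 0, j) \<in> a" "(i, 0, j) \<in> b" by auto
      obtain F where
        F: "finite F" "F \<subseteq> {0<..}" "layer0 ({0<..} - F) (i - 1) (j - 1) \<subseteq> a"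
        using Int.IH(1)[rule_format, OF ij(1,2) ab(1)] by (elim exE conjE)
      obtain G where
        G: "finite G" "G \<subseteq> {0<..}" "layer0 ({0<..} - G) (i - 1) (j - 1) \<subseteq> b"
        using Int.IH(2)[rule_format, OF ij(1,2) ab(2)] by (elim exE conjE)
      have "layer0 ({0<..} - (F \<union> G)) (i - 1) (j - 1)
          \<subseteq> layer0 ({0<..} - F) (i - 1) (j - 1) \<inter> layer0 ({0<..} - G) (i - 1) (j - 1)"
        by (auto simp: layer0_def layer_def)
      also have "\<dots> \<subseteq> a \<inter> b" by (rule Int_mono[OF F(3) G(3)])
      finally show "\<exists>F. finite F \<and> F \<subseteq> {0<..} \<and> layer0 ({0<..} - F) (i - 1) (j - 1) \<subseteq> a \<inter> b"
        using F(1,2) G(1,2) by (intro exI[of _ "F \<union> G"] conjI finite_UnI Un_least)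
    qed
  next
    case (UN K)
    show ?case
    proof (intro allI impI)
      fix i j :: nat
      assume ij: "0 < i" "0 < j" "(i, 0, j) \<in> \<Union>K"
      then obtain k where k: "k \<in> K" "(i, 0, j) \<in> k" by blast
      obtain F where
        "finite F" "F \<subseteq> {0<..}" "layer0 ({0<..} - F) (i - 1) (j - 1) \<subseteq> k"
        using UN.IH[rule_format, OF k(1) ij(1,2) k(2)] by (elim exE conjE)
      moreover have "k \<subseteq> \<Union>K" using k(1) by (rule Union_upper)
      ultimately show "\<exists>F. finite F \<and> F \<subseteq> {0<..} \<and> layer0 ({0<..} - F) (i - 1) (j - 1) \<subseteq> \<Union>K"
        by (intro exI[of _ F] conjI) (assumption | erule (1) subset_trans)+
    qed
  next
    case (Basis s)
    show ?case
    proof (intro allI impI)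
      fix i j :: nat
      assume ij: "0 < i" "0 < j" "(i, 0, j) \<in> s"
      with Basis have "\<exists>i' j' F. s = layer0 ({0<..} - F) (i' - 1) (j' - 1) \<and> 0 < i' \<and> 0 < j'
          \<and> finite F \<and> F \<subseteq> {0<..}"
        by (elim UnE CollectE exE conjE) (simp, blast)
      then obtain i' j' F where s: "s = layer0 ({0<..} - F) (i' - 1) (j' - 1)" "0 < i'" "0 < j'"
        and F: "finite F" "F \<subseteq> {0<..}" by blast
      from ij s have "i' = i" "j' = j" by (auto simp: layer0_def layer_def)
      with s F show "\<exists>F. finite F \<and> F \<subseteq> {0<..} \<and> layer0 ({0<..} - F) (i - 1) (j - 1) \<subseteq> s"
        by (intro exI[of _ F] conjI) simp_all
    qed
  qed
next
  assume U: "?P U"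
  have "\<exists>T. openin tau_plus T \<and> x \<in> T \<and> T \<subseteq> U" if "x \<in> U" for x
  proof -
    obtain i g j where x: "x = (i, g, j)" by (cases x)
    show ?thesis
    proof (cases "g \<noteq> 0 \<or> i = 0 \<or> j = 0")
      case True
      then have "openin tau_plus {x}"
        unfolding tau_plus_def x by (intro topology_generated_by_Basis) blast
      then show ?thesis using that by blast
    next
      case False
      then have ij: "0 < i" "0 < j" and x0: "x = (i, 0, j)" by (simp_all add: x)
      from that have "(i, 0, j) \<in> U" by (simp only: x0)
      from U[rule_format, OF ij this] obtain F where F: "finite F" "F \<subseteq> {0<..}"
        and FU: "layer0 ({0<..} - F) (i - 1) (j - 1) \<subseteq> U" by (elim exE conjE)
      have "openin tau_plus (layer0 ({0<..} - F) (i - 1) (j - 1))"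
        unfolding tau_plus_def using F ij
        by (intro topology_generated_by_Basis UnI2 CollectI exI conjI) (rule refl | assumption)+
      moreover have "x \<in> layer0 ({0<..} - F) (i - 1) (j - 1)"
        using ij by (simp add: x0 layer0_def)
      ultimately show ?thesis using FU by (intro exI conjI)
    qed
  qed
  then show "openin tau_plus U" by (subst openin_subopen) blast
qed

lemma topspace_tau_plus: "topspace tau_plus = UNIV"
proof -
  have "openin tau_plus UNIV" by (auto simp: openin_tau_plus)
  then show ?thesis using openin_subset by blast
qed

end

theory Submission
  imports Defs
begin

text \<open>
  Suppose that the zero is not isolated, and let \<open>K\<close> be a compact neighbourhood of it. Since \<open>\<theta>\<close>
  annihilates, right multiplication by \<open>(n + 1, 0, 0)\<close> forgets the middle coordinate of every
  \<open>(i, s, j)\<close> with \<open>j \<le> n\<close>, and so it collapses the union of all layers with \<open>i, j \<le> n\<close> to finitely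
  many nonzero points. By continuity the zero is not in the closure of that union
  (\<open>zero_avoids_low_layers\<close>). Hence \<open>K\<close> has points in layers with \<open>i\<close> or \<open>j\<close> arbitrarily large.

  On the other hand \<open>K\<close> is nearly invariant under every translation: the points of \<open>K\<close> that a
  translation throws out of \<open>K\<close> lie in a compact set of nonzero elements, and such a set is bounded in
  \<open>i\<close> and \<open>j\<close> from above and in \<open>s\<close> from below (\<open>compact_nbhd_translation\<close>). The lower bound on \<open>s\<close>
  reflects that under \<open>\<tau>\<^sub>+\<close> the points of a layer accumulate only as \<open>s\<close> tends to \<open>+\<infinity>\<close>, never as it
  tends to \<open>-\<infinity>\<close>.
  So a point of \<open>K\<close> in a remote layer can be shifted, inside \<open>K\<close>, first to a point \<open>(0, s, j)\<close> and
  then, by left multiplication by \<open>(0, -1, 0)\<close>, to all points \<open>(0, s - k, j)\<close>. These stay off a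
  neighbourhood of the zero, so they lie in a compact set of nonzero elements; but their
  middle coordinates are unbounded below, a contradiction.
\<close>

text \<open>These sets exhaust the semigroup and are open for \<open>\<tau>\<^sub>+\<close>, because the points that converge to
  \<open>(i, 0, j)\<close> have smaller outer and positive middle coordinates. They therefore serve to bound compact sets.\<close>

definition box :: "nat \<Rightarrow> reilly set" where
  "box n = {(i, s, j). i < n \<and> j < n \<and> - int n < s}"

lemma mem_box [simp]: "(i, s, j) \<in> box n \<longleftrightarrow> i < n \<and> j < n \<and> - int n < s"
  by (simp add: box_def)

lemma box_mono: "m \<le> n \<Longrightarrow> box m \<subseteq> box n"
  by (auto simp: box_def)

lemma in_some_box: "x \<in> box (Suc (fst x + nat \<bar>fst (snd x)\<bar> + snd (snd x)))"
  by (cases x) auto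

lemma openin_tau_plus_box: "openin tau_plus (box n)"
  unfolding openin_tau_plus
proof (intro allI impI)
  fix i j :: nat
  assume "0 < i" "0 < j" "(i, 0, j) \<in> box n"
  then have "layer0 ({0<..} - {}) (i - 1) (j - 1) \<subseteq> box n"
    by (auto simp: layer0_def layer_def)
  then show "\<exists>F. finite F \<and> F \<subseteq> {0<..} \<and> layer0 ({0<..} - F) (i - 1) (j - 1) \<subseteq> box n"
    by (intro exI[of _ "{}"]) simp
qed

lemma openin_nonzero_part:
  fixes \<tau> :: "'a option topology"
  assumes "topspace \<tau> = UNIV" "Hausdorff_space \<tau>"
    and "openin (pullback_topology UNIV Some \<tau>) W"
  shows "openin \<tau> (Some ` W)"
proof -
  obtain U where U: "openin \<tau> U" "W = Some -` U"
    using assms(3) by (auto simp: openin_pullback_topology)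
  have "x \<in> Some ` W \<longleftrightarrow> x \<in> U - {None}" for x
    unfolding U(2) by (cases x) auto
  then have "Some ` W = U - {None}"
    by blast
  moreover have "closedin \<tau> {None}"
    using assms(1,2) by (simp add: closedin_Hausdorff_finite)
  ultimately show ?thesis
    using U(1) by (simp add: openin_diff)
qed

lemma compact_nonzero_subset_box:
  assumes "topspace \<tau> = UNIV" "Hausdorff_space \<tau>"
    and "pullback_topology UNIV Some \<tau> = tau_plus"
    and "compactin \<tau> C" "None \<notin> C"
  obtains n where "C \<subseteq> Some ` box n"
proof -
  let ?U = "range (\<lambda>n. Some ` box n)"
  have "C \<subseteq> \<Union>?U"
  proof
    fix c assume "c \<in> C"
    with assms(5) obtain x where "c = Some x" by (cases c) auto
    then show "c \<in> \<Union>?U" using in_some_box[of x] by blast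
  qed
  moreover have "\<And>U. U \<in> ?U \<Longrightarrow> openin \<tau> U"
    using openin_nonzero_part[OF assms(1,2)] openin_tau_plus_box assms(3) by auto
  ultimately obtain \<F> where F: "finite \<F>" "\<F> \<subseteq> ?U" "C \<subseteq> \<Union>\<F>"
    using compactinD[OF assms(4), of ?U] by blast
  then obtain N where N: "finite N" "\<F> = (\<lambda>n. Some ` box n) ` N"
    by (meson finite_subset_image)
  have "\<Union>\<F> \<subseteq> Some ` box (Max N)"
    unfolding N(2) using box_mono Max_ge[OF N(1)] by blast
  with F(3) that show thesis by blast
qed

lemma compact_minus_nbhd_subset_box:
  assumes "topspace \<tau> = UNIV" "Hausdorff_space \<tau>"
    and "pullback_topology UNIV Some \<tau> = tau_plus"
    and "compactin \<tau> K" "openin \<tau> V" "None \<in> V"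
  obtains n where "K - V \<subseteq> Some ` box n"
proof -
  have "closedin \<tau> (UNIV - V)"
    using assms(1,5) by (metis openin_closedin_eq)
  then have "compactin \<tau> (K \<inter> (UNIV - V))"
    using assms(4) by (rule compact_Int_closedin[rotated])
  moreover have "K \<inter> (UNIV - V) = K - V" by blast
  ultimately show thesis
    using compact_nonzero_subset_box[OF assms(1-3)] that assms(6) by (metis DiffD2)
qed

text \<open>A continuous self-map that fixes the zero keeps a neighbourhood of it inside \<open>U\<close>, and what is
  left of \<open>K\<close> outside this neighbourhood is compact and avoids the zero.\<close>

lemma compact_nbhd_translation:
  assumes "topspace \<tau> = UNIV" "Hausdorff_space \<tau>"
    and "pullback_topology UNIV Some \<tau> = tau_plus"
    and "compactin \<tau> K" "openin \<tau> U" "None \<in> U" "U \<subseteq> K"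
    and "continuous_map \<tau> \<tau> f" "f None = None"
  obtains n where "\<And>x. Some x \<in> K \<Longrightarrow> x \<notin> box n \<Longrightarrow> f (Some x) \<in> K"
proof -
  have "openin \<tau> {x. f x \<in> U}"
    using openin_continuous_map_preimage[OF assms(8,5)] assms(1) by simp
  moreover have "None \<in> {x. f x \<in> U}"
    using assms(6,9) by simp
  ultimately obtain n where "K - {x. f x \<in> U} \<subseteq> Some ` box n"
    using compact_minus_nbhd_subset_box[OF assms(1-4)] by blast
  with assms(7) that show thesis by blast
qed

lemma funpow_annihilating: "((\<lambda>z::int. 0) ^^ k) s = (if k = 0 then s else 0)"
  by (cases k) auto

text \<open>The zero is fixed by the translation that collapses the low layers to the finite set \<open>F\<close> of the
  proof, and so has a neighbourhood whose image misses \<open>F\<close>.\<close>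

lemma zero_avoids_low_layers:
  assumes "topspace \<tau> = UNIV" "Hausdorff_space \<tau>"
    and "shift_continuous (adjoin_zero (reilly_mult (\<lambda>z. 0))) \<tau>"
  obtains V where "openin \<tau> V" "None \<in> V"
    and "\<And>i s j. i \<le> n \<Longrightarrow> j \<le> n \<Longrightarrow> Some (i, s, j) \<notin> V"
proof -
  let ?f = "\<lambda>x. adjoin_zero (reilly_mult (\<lambda>z. 0)) x (Some (Suc n, 0, 0))"
  define F :: "reilly option set" where "F = (\<lambda>k. Some (k, 0, 0)) ` {..2 * n + 1}"
  have "openin \<tau> (UNIV - F)"
    using assms(1,2) closedin_Hausdorff_finite[of \<tau> F] openin_diff[OF openin_topspace[of \<tau>]]
    by (simp add: F_def)
  moreover have cont: "continuous_map \<tau> \<tau> ?f"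
    using assms(1,3) by (simp add: shift_continuous_def)
  ultimately have "openin \<tau> {x. ?f x \<in> UNIV - F}"
    using openin_continuous_map_preimage assms(1) by fastforce
  moreover have "None \<in> {x. ?f x \<in> UNIV - F}"
    by (auto simp: F_def)
  moreover have "Some (i, s, j) \<notin> {x. ?f x \<in> UNIV - F}" if "i \<le> n" "j \<le> n" for i s j
    using that by (auto simp: F_def funpow_annihilating min_def)
  ultimately show thesis by (rule that)
qed

theorem theorem4p15:
  fixes \<theta> :: "int \<Rightarrow> int" and \<tau> :: "reilly option topology"
  assumes "\<theta> = (\<lambda>z. 0)"
    and "topspace \<tau> = UNIV"
    and "Hausdorff_space \<tau>"
    and "locally_compact_space \<tau>"
    and "shift_continuous (adjoin_zero (reilly_mult \<theta>)) \<tau>"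
    and "pullback_topology UNIV Some \<tau> = tau_plus"
  shows "openin \<tau> {None}"
proof (rule ccontr)
  assume nonisolated: "\<not> openin \<tau> {None}"
  note top = assms(2,3,6)
  note shift = assms(5)[unfolded assms(1)]
  let ?m = "adjoin_zero (reilly_mult (\<lambda>z. 0))"
  have cont: "continuous_map \<tau> \<tau> (?m a)" "continuous_map \<tau> \<tau> (\<lambda>x. ?m x a)" for a
    using shift assms(2) by (simp_all add: shift_continuous_def)
  obtain U K where UK: "openin \<tau> U" "compactin \<tau> K" "None \<in> U" "U \<subseteq> K"
    using assms(2,4) unfolding locally_compact_space_def by (metis UNIV_I)
  note translation = compact_nbhd_translation[OF top UK(2,1,3,4)]
  obtain n1 where n1: "\<And>x. Some x \<in> K \<Longrightarrow> x \<notin> box n1 \<Longrightarrow> ?m (Some x) (Some (0, 0, 1)) \<in> K"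
    using translation[OF cont(2)[of "Some (0, 0, 1)"]] by auto
  obtain n2 where n2: "\<And>x. Some x \<in> K \<Longrightarrow> x \<notin> box n2 \<Longrightarrow> ?m (Some (0, 0, 1)) (Some x) \<in> K"
    using translation[OF cont(1)[of "Some (0, 0, 1)"]] by auto
  obtain n3 where n3: "\<And>x. Some x \<in> K \<Longrightarrow> x \<notin> box n3 \<Longrightarrow> ?m (Some (0, -1, 0)) (Some x) \<in> K"
    using translation[OF cont(1)[of "Some (0, -1, 0)"]] by auto
  define n where "n = max n1 (max n2 n3)"
  have far: "(i, s, j) \<notin> box n1" "(i, s, j) \<notin> box n2" "(i, s, j) \<notin> box n3"
    if "n \<le> i \<or> n \<le> j" for i s j
    using that by (auto simp: n_def)
  have incr_right: "Some (i, s, Suc j) \<in> K" if "Some (i, s, j) \<in> K" "n \<le> i \<or> n \<le> j" for i s j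
    using n1[OF that(1) far(1)[OF that(2)]] by (simp add: funpow_annihilating)
  have decr_left: "Some (i, s, j) \<in> K" if "Some (Suc i, s, j) \<in> K" "n \<le> j" for i s j
    using n2[OF that(1) far(2)] that(2) by (simp add: funpow_annihilating)
  have decr_middle: "Some (0, s - 1, j) \<in> K" if "Some (0, s, j) \<in> K" "n \<le> j" for s j
    using n3[OF that(1) far(3)] that(2) by (simp add: funpow_annihilating)

  have to_row_0: "Some (0, s, j) \<in> K" if "Some (i, s, j) \<in> K" "n \<le> j" for i s j
    using that by (induction i) (auto intro: decr_left)
  have incr_right_iter: "Some (i, s, j + k) \<in> K" if "Some (i, s, j) \<in> K" "n \<le> i" for i s j k
    using that by (induction k) (auto intro: incr_right)

  obtain V where V: "openin \<tau> V" "None \<in> V" "\<And>i s j. i \<le> n \<Longrightarrow> j \<le> n \<Longrightarrow> Some (i, s, j) \<notin> V"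
    using zero_avoids_low_layers[OF assms(2,3) shift] by blast
  have UV: "openin \<tau> (U \<inter> V)"
    using UK(1) V(1) by (rule openin_Int)
  have "\<not> U \<inter> V \<subseteq> {None}"
  proof
    assume "U \<inter> V \<subseteq> {None}"
    with UK(3) V(2) have "U \<inter> V = {None}" by blast
    from UV[unfolded this] nonisolated show False by contradiction
  qed
  then obtain y where "y \<in> U \<inter> V" "y \<noteq> None"
    by blast
  then obtain i s j where x: "Some (i, s, j) \<in> U" "Some (i, s, j) \<in> V"
    by (cases y) auto
  then have xK: "Some (i, s, j) \<in> K" "n \<le> i \<or> n \<le> j"
    using UK(4) V(3) nat_le_linear by blast+
  \<comment> \<open>If only \<open>i\<close> is large, then \<open>j\<close> has to be raised first, so that lowering \<open>i\<close> stays in remote layers.\<close>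
  obtain l where l: "n \<le> l" "Some (0, s, l) \<in> K"
  proof (cases "n \<le> j")
    case True
    with xK to_row_0 that show thesis by blast
  next
    case False
    with xK have "Some (i, s, j + n) \<in> K" by (simp add: incr_right_iter)
    with to_row_0 that[of "j + n"] show thesis by simp
  qed
  have descent: "Some (0, s - int k, l) \<in> K" for k
  proof (induction k)
    case (Suc k)
    from decr_middle[OF this l(1)] show ?case by (simp add: algebra_simps)
  qed (simp add: l)

  obtain W where W: "openin \<tau> W" "None \<in> W" "\<And>i s j. i \<le> l \<Longrightarrow> j \<le> l \<Longrightarrow> Some (i, s, j) \<notin> W"
    using zero_avoids_low_layers[OF assms(2,3) shift] by blast
  obtain m where m: "K - W \<subseteq> Some ` box m"
    using compact_minus_nbhd_subset_box[OF top UK(2) W(1,2)] by blast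
  have "Some (0, s - int (nat \<bar>s\<bar> + m), l) \<in> Some ` box m"
    using m descent W(3) by blast
  then show False by (auto simp: image_iff)
qed

end
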